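(* Let $R_n^1,R_n^2,\dots,R_n^r$ be the lengths of the first $r$ rows, $1\le r\le m$, of the RSK Young diagram generated by a sequence $(X_k)_{1\le k\le n}$ whose elements belong to a totally ordered alphabet $\mathcal{A}_m=\{\alpha_1<\cdots<\alpha_m\}$. Then, for each $1\le r\le m$, the sum of the lengths of the first $r$ rows is $$\sum_{j=1}^rR_n^j=\max_{(k_{j,\ell})\in J_{r,m}}\ \sum_{j=1}^r\ \sum_{\ell=j}^{m-r+j}\left(a^\ell_{k_{j,\ell}}-a^\ell_{k_{j,\ell-1}}\right),$$ where $a_k^\ell$ is the number of occurrences of $\alpha_\ell$ among $(X_i)_{1\le i\le k}$ (with $a^\ell_0=0$), and $J_{r,m}$ is the set of integer arrays $(k_{j,\ell})_{1\le j\le r,\,0\le\ell\le m}$ such that $k_{j,\ell}=0$ for $0\le\ell\le j-1$; $k_{j,\ell}=n$ for $m-r+j\le\ell\le m$; $k_{j,\ell-1}\le k_{j,\ell}$ for $1\le\ell\le m$; and $k_{j+1,\ell+1}\le k_{j,\ell}$ for $1\le j\le r-1$, $0\le\ell\le m-1$.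
   Context: RSK Young diagram: the common shape of the pair of tableaux obtained by applying the Robinson–Schensted–Knuth correspondence to the word $X_1X_2\cdots X_n$ (row insertion, so that the first row length is the length of the longest weakly increasing subsequence); it has at most $m$ rows, and missing rows have length $0$. *)

theory Defs
  imports "HOL-Library.FuncSet"
begin

text \<open>Tableaux are lists of rows, top row first.  An entry displaces the leftmost entry that is
  strictly larger, so rows are weakly increasing; the second component is the displaced entry.\<close>

fun row_insert :: "'a::linorder \<Rightarrow> 'a list \<Rightarrow> 'a list \<times> 'a option" where
  "row_insert x [] = ([x], None)"
| "row_insert x (y # ys) =
    (if x < y then (x # ys, Some y)
     else (case row_insert x ys of (zs, b) \<Rightarrow> (y # zs, b)))"

text \<open>The second component is the index (from 0) of the row in which the new box was created.\<close>

fun tableau_insert :: "'a::linorder \<Rightarrow> 'a list list \<Rightarrow> 'a list list \<times> nat" where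
  "tableau_insert x [] = ([[x]], 0)"
| "tableau_insert x (R # T) =
    (case row_insert x R of
       (R', None) \<Rightarrow> (R' # T, 0)
     | (R', Some y) \<Rightarrow> (case tableau_insert y T of (T', i) \<Rightarrow> (R' # T', Suc i)))"

fun add_box :: "'b \<Rightarrow> nat \<Rightarrow> 'b list list \<Rightarrow> 'b list list" where
  "add_box k i [] = [[k]]"
| "add_box k 0 (R # T) = (R @ [k]) # T"
| "add_box k (Suc i) (R # T) = R # add_box k i T"

definition rsk_step ::
  "'a::linorder list list \<times> nat list list \<Rightarrow> nat \<times> 'a \<Rightarrow> 'a list list \<times> nat list list" where
  "rsk_step = (\<lambda>(P, Q) (k, x). case tableau_insert x P of (P', i) \<Rightarrow> (P', add_box k i Q))"

definition rsk :: "'a::linorder list \<Rightarrow> 'a list list \<times> nat list list" where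
  "rsk w = foldl rsk_step ([], []) (enumerate 1 w)"

definition tableau_shape :: "'a list list \<Rightarrow> nat list" where
  "tableau_shape T = map length T"

definition rsk_shape :: "'a::linorder list \<Rightarrow> nat list" where
  "rsk_shape w = tableau_shape (fst (rsk w))"

text \<open>Rows are numbered from 1, and rows not present in the diagram have length 0.\<close>

definition rsk_row_length :: "'a::linorder list \<Rightarrow> nat \<Rightarrow> nat" where
  "rsk_row_length w j =
    (if 1 \<le> j \<and> j \<le> length (rsk_shape w) then rsk_shape w ! (j - 1) else 0)"

definition occurrences :: "(nat \<Rightarrow> 'a) \<Rightarrow> (nat \<Rightarrow> 'a) \<Rightarrow> nat \<Rightarrow> nat \<Rightarrow> nat" where
  "occurrences X \<alpha> l k = card {i \<in> {1..k}. X i = \<alpha> l}"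

text \<open>Natural-number entries lose nothing: \<open>k j 0 = 0\<close> and monotonicity in \<open>l\<close> force
  nonnegative entries.\<close>

definition J_arrays :: "nat \<Rightarrow> nat \<Rightarrow> nat \<Rightarrow> (nat \<Rightarrow> nat \<Rightarrow> nat) set" where
  "J_arrays n r m = {k \<in> {1..r} \<rightarrow>\<^sub>E ({0..m} \<rightarrow>\<^sub>E (UNIV :: nat set)).
     (\<forall>j\<in>{1..r}. \<forall>l\<in>{0..j - 1}. k j l = 0) \<and>
     (\<forall>j\<in>{1..r}. \<forall>l\<in>{m - r + j..m}. k j l = n) \<and>
     (\<forall>j\<in>{1..r}. \<forall>l\<in>{1..m}. k j (l - 1) \<le> k j l) \<and>
     (\<forall>j\<in>{1..r - 1}. \<forall>l\<in>{0..m - 1}. k (j + 1) (l + 1) \<le> k j l)}"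


lemma row_insert_None:
  "row_insert x R = (R', None) \<Longrightarrow> length R' = Suc (length R)"
  by (induction R arbitrary: R') (auto split: if_splits prod.splits)

lemma row_insert_Some:
  "row_insert x R = (R', Some y) \<Longrightarrow> length R' = length R"
  by (induction R arbitrary: R') (auto split: if_splits prod.splits)

lemma shape_tableau_insert:
  assumes "tableau_insert x P = (P', i)" "map length Q = map length P"
  shows "map length (add_box k i Q) = map length P'"
  using assms
proof (induction x P arbitrary: P' i Q rule: tableau_insert.induct)
  case (1 x)
  then show ?case by auto
next
  case (2 x R T)
  then obtain S U where Q: "Q = S # U" by (cases Q) auto
  show ?case
  proof (cases "row_insert x R")
    case (Pair R' b)
    show ?thesis
    proof (cases b)
      case None
      then show ?thesis using 2 Pair Q row_insert_None by fastforce
    next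
      case (Some y)
      obtain T' i' where T': "tableau_insert y T = (T', i')" by fastforce
      have "map length (add_box k i' U) = map length T'"
        using "2.IH"[OF Pair[symmetric] Some T'] "2.prems"(2) Q by simp
      moreover have "length R' = length R" using Pair Some row_insert_Some by blast
      moreover have "P' = R' # T'" "i = Suc i'" using "2.prems"(1) Pair Some T' by auto
      ultimately show ?thesis using "2.prems"(2) Q by simp
    qed
  qed
qed

lemma rsk_same_shape:
  "tableau_shape (snd (rsk w)) = tableau_shape (fst (rsk w))"
proof -
  have "map length (snd (foldl rsk_step (P, Q) kxs)) = map length (fst (foldl rsk_step (P, Q) kxs))"
    if "map length Q = map length P" for P :: "'a list list" and Q kxs
    using that
  proof (induction kxs arbitrary: P Q)
    case (Cons kx kxs)
    obtain k x where kx: "kx = (k, x)" by fastforce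
    obtain P' i where P': "tableau_insert x P = (P', i)" by fastforce
    show ?case
      using Cons.IH[OF shape_tableau_insert[OF P' Cons.prems, of k]] kx P'
      by (simp add: rsk_step_def)
  qed simp
  then show ?thesis by (simp add: rsk_def tableau_shape_def)
qed


lemma J_arrays_le:
  assumes "k \<in> J_arrays n r m" "j \<in> {1..r}" "l \<le> m" "r \<le> m"
  shows "k j l \<le> n"
  using assms(3)
proof (induction l rule: inc_induct)
  case base
  have "m \<in> {m - r + j..m}" using assms(2,4) by auto
  then have "k j m = n" using assms(1,2) unfolding J_arrays_def by blast
  then show ?case by simp
next
  case (step l)
  have mono: "\<forall>l\<in>{1..m}. k j (l - 1) \<le> k j l"
    using assms(1,2) unfolding J_arrays_def by blast
  have "k j (Suc l - 1) \<le> k j (Suc l)" by (rule bspec[OF mono]) (use step in auto)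
  then show ?case using step by simp
qed

lemma finite_J_arrays:
  assumes "r \<le> m"
  shows "finite (J_arrays n r m)"
proof (rule finite_subset)
  show "J_arrays n r m \<subseteq> {1..r} \<rightarrow>\<^sub>E ({0..m} \<rightarrow>\<^sub>E {0..n})"
  proof
    fix k assume k: "k \<in> J_arrays n r m"
    then have e: "k \<in> {1..r} \<rightarrow>\<^sub>E ({0..m} \<rightarrow>\<^sub>E (UNIV :: nat set))"
      unfolding J_arrays_def by blast
    show "k \<in> {1..r} \<rightarrow>\<^sub>E ({0..m} \<rightarrow>\<^sub>E {0..n})"
    proof (rule PiE_I)
      fix j assume j: "j \<in> {1..r}"
      have "k j \<in> {0..m} \<rightarrow>\<^sub>E (UNIV :: nat set)" by (rule PiE_mem[OF e j])
      then show "k j \<in> {0..m} \<rightarrow>\<^sub>E {0..n}"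
        using J_arrays_le[OF k j _ assms] by (auto simp: PiE_iff)
    next
      fix j assume "j \<notin> {1..r}"
      then show "k j = undefined" by (rule PiE_arb[OF e])
    qed
  qed
  show "finite ({1..r} \<rightarrow>\<^sub>E ({0..m} \<rightarrow>\<^sub>E {0..n}))" by (intro finite_PiE) auto
qed

lemma J_arrays_nonempty:
  assumes "r \<le> m"
  shows "J_arrays n r m \<noteq> {}"
proof -
  have "(\<lambda>j\<in>{1..r}. \<lambda>l\<in>{0..m}. if l < j then 0 else n) \<in> J_arrays n r m"
    using assms unfolding J_arrays_def by (auto simp: PiE_iff)
  then show ?thesis by blast
qed

end

theory Submission
  imports Defs "HOL-Library.Sublist"
begin

text \<open>
  An array in \<open>J_arrays n r m\<close> is the same as a weakly increasing chain of \<open>r\<close>-subsets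
  \<open>S\<^sub>1 \<le> \<dots> \<le> S\<^sub>n\<close> of \<open>{1..m}\<close> (path \<open>j\<close> carries letter \<open>l\<close> at the times in
  \<open>{k j (l - 1)<..k j l}\<close>), and its weight is the number of times \<open>t\<close> at which the \<open>t\<close>-th letter
  of the word lies in \<open>S\<^sub>t\<close>.  Given the times at which the letter has to be caught there is a
  least chain: to catch \<open>x\<close>, replace the largest element \<open>\<le> x\<close> by \<open>x\<close>.  In terms of this greedy
  action, the maximal weight for prescribed first and last sets is invariant under the Knuth
  relations, so the word may be replaced by the row reading word of its insertion tableau.  There,
  the top \<open>r\<close> rows can be caught completely, and at most \<open>r\<close> letters can be caught in each column
  because the column is read in decreasing order.
\<close>

subsection \<open>The greedy action and the Knuth relations\<close>

text \<open>A set \<open>S\<close> is encoded by its counting function \<open>c t = card (S \<inter> {..t})\<close>; larger sets have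
  smaller counting functions.  Replacing the largest element \<open>\<le> x\<close> by \<open>x\<close> is then \<open>bump x\<close>, and a
  replacement that is impossible because \<open>S \<inter> {..x}\<close> is empty shows up as a negative value.\<close>

definition bump :: "nat \<Rightarrow> (nat \<Rightarrow> int) \<Rightarrow> nat \<Rightarrow> int" where
  "bump x c = (\<lambda>t. if t < x then min (c t) (c x - 1) else c t)"

lemma bump_le: "bump x c \<le> c"
  by (auto simp: bump_def le_fun_def)

lemma bump_mono:
  assumes "c \<le> d"
  shows "bump x c \<le> bump x d"
proof (rule le_funI)
  fix t
  have "c t \<le> d t" "c x \<le> d x" using assms by (auto simp: le_fun_def)
  then show "bump x c t \<le> bump x d t" by (auto simp: bump_def)
qed

lemma mono_bump:
  assumes "mono c"
  shows "mono (bump x c)"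
proof (rule monoI)
  fix s t :: nat assume "s \<le> t"
  with assms have "c s \<le> c t" "x \<le> t \<Longrightarrow> c x \<le> c t"
    by (auto intro: monoD)
  then show "bump x c s \<le> bump x c t" using \<open>s \<le> t\<close> by (auto simp: bump_def)
qed

lemma fold_bump_mono: "c \<le> d \<Longrightarrow> fold bump v c \<le> fold bump v d"
  by (induction v arbitrary: c d) (auto intro: bump_mono)

lemma mono_fold_bump: "mono c \<Longrightarrow> mono (fold bump v c)"
  by (induction v arbitrary: c) (auto intro: mono_bump)

text \<open>Each additional catch lowers the counting function, and later catches preserve this
  because \<open>bump\<close> is monotone in its state.\<close>

lemma fold_bump_subseq: "subseq u v \<Longrightarrow> fold bump v c \<le> fold bump u c"
proof (induction arbitrary: c rule: list_emb.induct)
  case (list_emb_Nil ys)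
  then show ?case
  proof (induction ys arbitrary: c)
    case (Cons a ys)
    then show ?case using bump_le[of a c] by (metis fold_simps order.trans)
  qed simp
next
  case (list_emb_Cons xs ys y)
  then show ?case by (metis bump_le fold_bump_mono fold_simps(2) order.trans)
qed simp

text \<open>If the set has no element above \<open>x\<close> and up to \<open>z\<close>, catching
  \<open>x\<close> and then \<open>z\<close> moves one element twice, whereas \<open>z\<close>
  before \<open>x\<close> uses up two elements.\<close>

lemma bump_commute_le:
  "x < z \<Longrightarrow> bump x (bump z c) \<le> bump z (bump x c)"
  by (auto simp: bump_def le_fun_def)

text \<open>\<open>c x < c z\<close> provides an element above \<open>x\<close> and up to
  \<open>z\<close>, so the catches of \<open>x\<close> and \<open>z\<close> move different elements
  and do not interfere.\<close>

lemma bump_commute: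
  "x < z \<Longrightarrow> c x < c z \<Longrightarrow> bump x (bump z c) = bump z (bump x c)"
  by (auto simp: bump_def fun_eq_iff)

text \<open>The choice of \<open>v'\<close> may depend on \<open>c\<close>: the length-two cases of the Knuth relations need this.\<close>

definition dominated :: "nat list \<Rightarrow> nat list \<Rightarrow> bool" where
  "dominated u u' \<longleftrightarrow> (\<forall>c v. mono c \<longrightarrow> subseq v u \<longrightarrow>
     (\<exists>v'. subseq v' u' \<and> length v' = length v \<and> fold bump v c \<le> fold bump v' c))"

lemma dominatedI:
  assumes "\<And>c v. mono c \<Longrightarrow> subseq v u \<Longrightarrow> \<not> subseq v u' \<Longrightarrow>
    \<exists>v'. subseq v' u' \<and> length v' = length v \<and> fold bump v c \<le> fold bump v' c"
  shows "dominated u u'"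
  unfolding dominated_def using assms by (metis order.refl)

lemma dominated_refl: "dominated u u"
  unfolding dominated_def by blast

lemma dominated_trans: "dominated u v \<Longrightarrow> dominated v w \<Longrightarrow> dominated u w"
  unfolding dominated_def by (metis order.trans)

text \<open>The quantifier over all monotone \<open>c\<close> in \<open>dominated\<close> absorbs
  the prefix into the state; the suffix is handled by monotonicity of
  \<open>fold bump\<close>.\<close>

lemma dominated_append:
  assumes "dominated u u'"
  shows "dominated (p @ u @ s) (p @ u' @ s)"
  unfolding dominated_def
proof (intro allI impI)
  fix c :: "nat \<Rightarrow> int" and v assume c: "mono c" and "subseq v (p @ u @ s)"
  then obtain a b d where v: "v = a @ b @ d" "subseq a p" "subseq b u" "subseq d s"
    by (metis subseq_appendE)
  obtain b' where b': "subseq b' u'" "length b' = length b"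
      "fold bump b (fold bump a c) \<le> fold bump b' (fold bump a c)"
    using assms v(3) mono_fold_bump[OF c] unfolding dominated_def by blast
  have "subseq (a @ b' @ d) (p @ u' @ s)" using v b' by (intro list_emb_append_mono)
  moreover have "fold bump v c \<le> fold bump (a @ b' @ d) c"
    using fold_bump_mono[OF b'(3)] v(1) by simp
  ultimately show "\<exists>v'. subseq v' (p @ u' @ s) \<and> length v' = length v \<and> fold bump v c \<le> fold bump v' c"
    using v(1) b'(2) by (intro exI[of _ "a @ b' @ d"]) simp
qed

definition reach_equiv :: "nat list \<Rightarrow> nat list \<Rightarrow> bool" where
  "reach_equiv u u' \<longleftrightarrow> dominated u u' \<and> dominated u' u"

lemma reach_equiv_refl [simp]: "reach_equiv u u"
  by (simp add: reach_equiv_def dominated_refl)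

lemma reach_equiv_trans [trans]: "reach_equiv u v \<Longrightarrow> reach_equiv v w \<Longrightarrow> reach_equiv u w"
  unfolding reach_equiv_def by (blast intro: dominated_trans)

lemma reach_equiv_append: "reach_equiv u u' \<Longrightarrow> reach_equiv (p @ u @ s) (p @ u' @ s)"
  unfolding reach_equiv_def by (blast intro: dominated_append)

lemma subseq3_cases:
  assumes "subseq v [a, b, c]"
  obtains "v = []" | "v = [a]" | "v = [b]" | "v = [c]" | "v = [a, b]" | "v = [a, c]"
    | "v = [b, c]" | "v = [a, b, c]"
proof -
  have "v \<in> set (subseqs [a, b, c])" using assms by (simp add: subseqs_powset flip: in_set_subseqs)
  then show ?thesis using that by (auto simp: Let_def)
qed

text \<open>Once \<open>y\<close> is caught, an element lies above \<open>x\<close> and up to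
  \<open>z\<close>, so the remaining two catches commute. Only a two-letter choice without
  \<open>y\<close> needs another argument.\<close>

lemma knuth1:
  assumes "x < y" "y \<le> z"
  shows "reach_equiv [y, z, x] [y, x, z]"
  unfolding reach_equiv_def
proof
  have xz: "x < z" using assms by simp
  have c3: "bump x (bump z (bump y c)) = bump z (bump x (bump y c))" if "mono c" for c
    using assms that by (intro bump_commute) (auto simp: bump_def mono_def, smt (verit))
  have eq: "c x = c z \<Longrightarrow> mono c \<Longrightarrow> c y = c z" for c :: "nat \<Rightarrow> int"
    using assms xz unfolding mono_def by (metis order.antisym less_imp_le)
  show "dominated [y, z, x] [y, x, z]"
  proof (rule dominatedI)
    fix c :: "nat \<Rightarrow> int" and v
    assume c: "mono c" and v: "subseq v [y, z, x]" and new: "\<not> subseq v [y, x, z]"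
    let ?P = "\<lambda>v'. subseq v' [y, x, z] \<and> length v' = length v \<and> fold bump v c \<le> fold bump v' c"
    show "\<exists>v'. ?P v'"
      using v
    proof (cases rule: subseq3_cases)
      case 7
      have "?P [x, z]" using 7 bump_commute_le[OF xz] by simp
      then show ?thesis by blast
    next
      case 8
      then have "?P [y, x, z]" using c3[OF c] by simp
      then show ?thesis by blast
    qed (use new in \<open>simp_all split: if_splits\<close>)
  qed
  show "dominated [y, x, z] [y, z, x]"
  proof (rule dominatedI)
    fix c :: "nat \<Rightarrow> int" and v
    assume c: "mono c" and v: "subseq v [y, x, z]" and new: "\<not> subseq v [y, z, x]"
    let ?P = "\<lambda>v'. subseq v' [y, z, x] \<and> length v' = length v \<and> fold bump v c \<le> fold bump v' c"
    show "\<exists>v'. ?P v'"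
      using v
    proof (cases rule: subseq3_cases)
      case 7
      show ?thesis
      proof (cases "c x < c z")
        case True
        then have "?P [z, x]" using 7 bump_commute[of x z c] xz by simp
        then show ?thesis by blast
      next
        \<comment> \<open>No element lies above \<open>x\<close> and up to \<open>z\<close>:
          catching \<open>x\<close> and then \<open>z\<close> carries a single element to
          \<open>z\<close>, and a stop at \<open>y\<close> on the way gives the same result.\<close>
        case False
        then have "c x = c z" using monoD[OF c, of x z] xz by simp
        then have "?P [y, z]" using 7 eq[OF _ c] assms xz
          by (auto simp: bump_def le_fun_def)
        then show ?thesis by blast
      qed
    next
      case 8
      then have "?P [y, z, x]" using c3[OF c] by simp
      then show ?thesis by blast
    qed (use new in \<open>simp_all split: if_splits\<close>)
  qed
qed

text \<open>The last catch evens out the two orders: if no element lies above \<open>x\<close> and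
  up to \<open>z\<close>, then either way the two largest elements at most \<open>x\<close> end at
  \<open>y\<close> and \<open>z\<close>.\<close>

lemma knuth2:
  assumes "x \<le> y" "y < z"
  shows "reach_equiv [x, z, y] [z, x, y]"
  unfolding reach_equiv_def
proof
  have xz: "x < z" using assms by simp
  have eq: "c x = c z \<Longrightarrow> mono c \<Longrightarrow> c y = c z" for c :: "nat \<Rightarrow> int"
    using assms xz unfolding mono_def by (metis order.antisym less_imp_le)
  have c3: "bump y (bump x (bump z c)) = bump y (bump z (bump x c))" if "mono c" for c
  proof (cases "c x < c z")
    case False
    then have "c x = c z" using monoD[OF that, of x z] xz by simp
    then show ?thesis using eq[OF _ that] assms xz
      by (auto simp: bump_def fun_eq_iff)
  qed (use xz bump_commute[of x z c] in auto)
  show "dominated [x, z, y] [z, x, y]"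
  proof (rule dominatedI)
    fix c :: "nat \<Rightarrow> int" and v
    assume c: "mono c" and v: "subseq v [x, z, y]" and new: "\<not> subseq v [z, x, y]"
    let ?P = "\<lambda>v'. subseq v' [z, x, y] \<and> length v' = length v \<and> fold bump v c \<le> fold bump v' c"
    show "\<exists>v'. ?P v'"
      using v
    proof (cases rule: subseq3_cases)
      case 5
      show ?thesis
      proof (cases "c x < c z")
        case True
        then have "?P [z, x]" using 5 bump_commute[of x z c] xz by simp
        then show ?thesis by blast
      next
        \<comment> \<open>Both \<open>[x, z]\<close> and \<open>[x, y]\<close> move a single element
          here, and ending at \<open>y\<close> leaves counts at least as large as ending at
          \<open>z\<close>.\<close>
        case False
        then have "c x = c z" using monoD[OF c, of x z] xz by simp
        then have "?P [x, y]" using 5 eq[OF _ c] assms xz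
          by (auto simp: bump_def le_fun_def)
        then show ?thesis by blast
      qed
    next
      case 8
      then have "?P [z, x, y]" using c3[OF c] by simp
      then show ?thesis by blast
    qed (use new in \<open>simp_all split: if_splits\<close>)
  qed
  show "dominated [z, x, y] [x, z, y]"
  proof (rule dominatedI)
    fix c :: "nat \<Rightarrow> int" and v
    assume c: "mono c" and v: "subseq v [z, x, y]" and new: "\<not> subseq v [x, z, y]"
    let ?P = "\<lambda>v'. subseq v' [x, z, y] \<and> length v' = length v \<and> fold bump v c \<le> fold bump v' c"
    show "\<exists>v'. ?P v'"
      using v
    proof (cases rule: subseq3_cases)
      case 5
      have "?P [x, z]" using 5 bump_commute_le[OF xz] by simp
      then show ?thesis by blast
    next
      case 8
      then have "?P [x, z, y]" using c3[OF c] by simp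
      then show ?thesis by blast
    qed (use new in \<open>simp_all split: if_splits\<close>)
  qed
qed

subsection \<open>Row insertion\<close>

lemma row_insert_NoneD:
  "row_insert x R = (R', None) \<Longrightarrow> R' = R @ [x] \<and> (\<forall>e\<in>set R. e \<le> x)"
  by (induction R arbitrary: R') (auto split: if_splits prod.splits)

lemma row_insert_SomeD:
  "row_insert x R = (R', Some y) \<Longrightarrow>
    \<exists>u v. R = u @ y # v \<and> R' = u @ x # v \<and> (\<forall>e\<in>set u. e \<le> x) \<and> x < y"
proof (induction R arbitrary: R')
  case (Cons a R)
  show ?case
  proof (cases "x < a")
    case True
    then show ?thesis using Cons.prems by (intro exI[of _ "[]"] exI[of _ R]) auto
  next
    case False
    then obtain S where S: "row_insert x R = (S, Some y)" "R' = a # S"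
      using Cons.prems by (auto split: prod.splits)
    from Cons.IH[OF S(1)] obtain u v where
      "R = u @ y # v" "S = u @ x # v" "\<forall>e\<in>set u. e \<le> x" "x < y" by blast
    then show ?thesis using False S(2) by (intro exI[of _ "a # u"] exI[of _ v]) auto
  qed
qed simp

text \<open>\<open>x\<close> travels left through the row by \<open>knuth1\<close>: it passes a
  letter with the help of the preceding one, which also exceeds \<open>x\<close>.\<close>

lemma reach_equiv_move_left:
  "x < y \<Longrightarrow> sorted (y # v) \<Longrightarrow> reach_equiv (y # v @ [x]) (y # x # v)"
proof (induction v rule: rev_induct)
  case (snoc z v)
  show ?case
  proof (cases v rule: rev_cases)
    case Nil
    then show ?thesis using snoc knuth1[of x y z] by simp
  next
    case (snoc v' z')
    have z: "x < z'" "z' \<le> z" using snoc.prems snoc by (auto simp: sorted_append)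
    have "reach_equiv (y # (v @ [z]) @ [x]) (y # v @ [x, z])"
      using reach_equiv_append[OF knuth1[OF z], of "y # v'" "[]"] snoc by simp
    also have "reach_equiv (y # v @ [x, z]) (y # x # v @ [z])"
      using reach_equiv_append[OF snoc.IH, of "[]" "[z]"] snoc.prems by (simp add: sorted_append)
    finally show ?thesis .
  qed
qed simp

text \<open>The displaced entry travels left by \<open>knuth2\<close>: it passes \<open>a\<close>
  with the first letter of \<open>u @ [x]\<close> as the third letter of the relation.\<close>

lemma reach_equiv_move_right:
  "\<forall>e\<in>set u. e \<le> x \<Longrightarrow> x < y \<Longrightarrow> sorted u \<Longrightarrow> reach_equiv (u @ [y, x]) (y # u @ [x])"
proof (induction u)
  case (Cons a u)
  have "reach_equiv ((a # u) @ [y, x]) (a # y # u @ [x])"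
    using reach_equiv_append[OF Cons.IH, of "[a]" "[]"] Cons.prems by simp
  also obtain b s where b: "u @ [x] = b # s" by (cases "u @ [x]") auto
  then have "a \<le> b" "b < y" using Cons.prems by (cases u; auto)+
  then have "reach_equiv (a # y # u @ [x]) (y # (a # u) @ [x])"
    using reach_equiv_append[OF knuth2, of a b y "[]" s] b by simp
  finally show ?case .
qed simp

lemma reach_equiv_row_insert:
  assumes "sorted R" "row_insert x R = (R', Some y)"
  shows "reach_equiv (R @ [x]) (y # R')"
proof -
  obtain u v where R: "R = u @ y # v" "R' = u @ x # v" "\<forall>e\<in>set u. e \<le> x" "x < y"
    using row_insert_SomeD[OF assms(2)] by blast
  have "reach_equiv (R @ [x]) (u @ y # x # v)"
    using reach_equiv_append[OF reach_equiv_move_left, of x y v u "[]"] R assms(1)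
    by (simp add: sorted_append)
  also have "reach_equiv (u @ y # x # v) (y # R')"
    using reach_equiv_append[OF reach_equiv_move_right, of u x y "[]" v] R assms(1)
    by (simp add: sorted_append)
  finally show ?thesis .
qed

text \<open>Rows are read from the bottom up, so a displaced entry, moved to the front of its row,
  stands right after the word of the rows below, as if appended to it.\<close>

lemma reach_equiv_tableau_insert:
  "\<forall>R\<in>set T. sorted R \<Longrightarrow>
    reach_equiv (concat (rev T) @ [x]) (concat (rev (fst (tableau_insert x T))))"
proof (induction x T rule: tableau_insert.induct)
  case (2 x R T)
  obtain R' b where Rb: "row_insert x R = (R', b)" by fastforce
  show ?case
  proof (cases b)
    case None
    then show ?thesis using Rb row_insert_NoneD by fastforce
  next
    case (Some y)
    have "reach_equiv (concat (rev (R # T)) @ [x]) (concat (rev T) @ y # R')"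
      using reach_equiv_append[OF reach_equiv_row_insert, of R x R' y "concat (rev T)" "[]"] 2 Rb Some
      by simp
    also have "reach_equiv (concat (rev T) @ y # R') (concat (rev (fst (tableau_insert y T))) @ R')"
      using reach_equiv_append[OF "2.IH"[OF Rb[symmetric] Some], of "[]" R'] 2(2) by simp
    also have "\<dots> = concat (rev (fst (tableau_insert x (R # T))))"
      using Rb Some by (simp split: prod.splits)
    finally show ?thesis .
  qed
qed simp

section \<open>Strict columns of the insertion tableau\<close>

definition row_above :: "'a::linorder list \<Rightarrow> 'a list \<Rightarrow> bool" where
  "row_above R S \<longleftrightarrow> length S \<le> length R \<and> (\<forall>j<length S. R ! j < S ! j)"

fun tableau :: "'a::linorder list list \<Rightarrow> bool" where
  "tableau [] = True"
| "tableau (R # T) = (sorted R \<and> row_above R (if T = [] then [] else hd T) \<and> tableau T)"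

lemma tableau_sorted: "tableau T \<Longrightarrow> \<forall>R\<in>set T. sorted R"
  by (induction T) auto

text \<open>The displaced entry lands in the next row weakly to the left of the column it left,
  because the entry below it there, if any, is larger than \<open>y\<close>.\<close>

lemma row_above_row_insert:
  assumes "row_insert x R = (R', Some y)" "row_above R S"
  shows "row_above R' (fst (row_insert y S))"
proof -
  obtain u v where R: "R = u @ y # v" "R' = u @ x # v" "\<forall>e\<in>set u. e \<le> x" "x < y"
    using row_insert_SomeD[OF assms(1)] by blast
  have le: "R' ! j \<le> R ! j" for j using R by (auto simp: nth_append nth_Cons split: nat.splits)
  \<comment> \<open>Up to the column of the displaced entry all letters are now below
    \<open>y\<close>, so \<open>y\<close> may stand under any of them.\<close>
  have small: "R' ! j < y" if "j \<le> length u" for j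
    using R that by (cases "j = length u") (auto simp: nth_append intro: le_less_trans)
  obtain S' b where S: "row_insert y S = (S', b)" by fastforce
  show ?thesis
  proof (cases b)
    case None
    then have S': "S' = S @ [y]" "\<forall>e\<in>set S. e \<le> y" using row_insert_NoneD S by blast+
    have len: "length S \<le> length u"
    proof (rule ccontr)
      assume "\<not> ?thesis"
      then have "R ! length u < S ! length u" "S ! length u \<in> set S"
        using assms(2) by (auto simp: row_above_def)
      then show False using S'(2) R(1) by (auto simp: nth_append)
    qed
    have "R' ! j < S' ! j" if "j < length S'" for j
    proof (cases "j < length S")
      case True
      then have "R ! j < S ! j" using assms(2) by (simp add: row_above_def)
      then show ?thesis using le[of j] True S'(1) by (simp add: nth_append)
    next
      case False
      then have "j = length S" using that S'(1) by simp
      then show ?thesis using small[of j] len S'(1) by simp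
    qed
    then show ?thesis using S S'(1) len R by (simp add: row_above_def)
  next
    case (Some z)
    then obtain u2 v2 where S': "S = u2 @ z # v2" "S' = u2 @ y # v2" "\<forall>e\<in>set u2. e \<le> y" "y < z"
      using row_insert_SomeD S by blast
    have len: "length u2 \<le> length u"
    proof (rule ccontr)
      assume *: "\<not> ?thesis"
      then have "S ! length u = u2 ! length u" "length u < length S"
        using S'(1) by (auto simp: nth_append)
      moreover from this have "R ! length u < S ! length u"
        using assms(2) unfolding row_above_def by blast
      moreover have "u2 ! length u \<in> set u2" using * by simp
      ultimately have "y < u2 ! length u" "u2 ! length u \<le> y" using S'(3) R(1) by auto
      then show False by simp
    qed
    have "R' ! j < S' ! j" if "j < length S'" for j
    proof (cases "j = length u2")
      case True
      then show ?thesis using small[of j] len S'(2) by simp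
    next
      case False
      then have "R ! j < S ! j" using assms(2) that S' by (simp add: row_above_def)
      moreover have "S' ! j = S ! j" using False S' by (auto simp: nth_append nth_Cons split: nat.splits)
      ultimately show ?thesis using le[of j] by simp
    qed
    then show ?thesis using S S' R assms(2) by (simp add: row_above_def)
  qed
qed

lemma sorted_row_insert:
  assumes "sorted R"
  shows "sorted (fst (row_insert x R))"
proof -
  obtain R' b where Rb: "row_insert x R = (R', b)" by fastforce
  show ?thesis
  proof (cases b)
    case None
    then show ?thesis using Rb row_insert_NoneD assms by (fastforce simp: sorted_append)
  next
    case (Some y)
    then show ?thesis using Rb row_insert_SomeD[of x R R' y] assms by (force simp: sorted_append)
  qed
qed

lemma tableau_insert_hd:
  "fst (tableau_insert x T) \<noteq> [] \<and>
    hd (fst (tableau_insert x T)) = fst (row_insert x (if T = [] then [] else hd T))"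
  by (cases T) (auto split: prod.splits option.splits)

lemma tableau_tableau_insert: "tableau T \<Longrightarrow> tableau (fst (tableau_insert x T))"
proof (induction x T rule: tableau_insert.induct)
  case (2 x R T)
  obtain R' b where Rb: "row_insert x R = (R', b)" by fastforce
  have s: "sorted R'" using sorted_row_insert[of R x] 2 Rb by simp
  show ?case
  proof (cases b)
    case None
    then show ?thesis using s Rb row_insert_NoneD[of x R R'] 2
      by (auto simp: row_above_def nth_append)
  next
    case (Some y)
    have "tableau (fst (tableau_insert y T))" using 2 Rb Some by auto
    moreover have "row_above R' (hd (fst (tableau_insert y T)))"
      using row_above_row_insert[of x R R' y "if T = [] then [] else hd T"] 2(2) Rb Some
        tableau_insert_hd[of y T] by (simp split: if_splits)
    ultimately show ?thesis using s Rb Some tableau_insert_hd[of y T] by (auto split: prod.splits)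
  qed
qed (simp add: row_above_def)

lemma set_tableau_insert:
  "set (concat (fst (tableau_insert x T))) \<subseteq> insert x (set (concat T))"
proof (induction x T rule: tableau_insert.induct)
  case (2 x R T)
  obtain R' b where Rb: "row_insert x R = (R', b)" by fastforce
  show ?case
  proof (cases b)
    case None
    then show ?thesis using Rb row_insert_NoneD by fastforce
  next
    case (Some y)
    from row_insert_SomeD Rb Some have "set R' \<subseteq> insert x (set R)" "y \<in> set R" by fastforce+
    moreover have "set (concat (fst (tableau_insert y T))) \<subseteq> insert y (set (concat T))"
      using 2 Rb Some by simp
    ultimately show ?thesis using Rb Some by (cases "tableau_insert y T") (simp, blast)
  qed
qed simp

definition P_tableau :: "'a::linorder list \<Rightarrow> 'a list list" where
  "P_tableau w = foldl (\<lambda>P x. fst (tableau_insert x P)) [] w"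

lemma P_tableau_snoc: "P_tableau (w @ [x]) = fst (tableau_insert x (P_tableau w))"
  by (simp add: P_tableau_def)

lemma fst_rsk: "fst (rsk w) = P_tableau w"
proof -
  have "fst (foldl rsk_step (P, Q) kxs) = foldl (\<lambda>P x. fst (tableau_insert x P)) P (map snd kxs)"
    for P :: "'a list list" and Q kxs
    by (induction kxs arbitrary: P Q) (auto simp: rsk_step_def split: prod.splits)
  then show ?thesis by (simp add: rsk_def P_tableau_def)
qed

lemma tableau_P_tableau: "tableau (P_tableau w)"
  by (induction w rule: rev_induct)
    (auto simp: P_tableau_snoc tableau_tableau_insert, simp add: P_tableau_def)

lemma set_P_tableau: "set (concat (P_tableau w)) \<subseteq> set w"
proof (induction w rule: rev_induct)
  case (snoc x w)
  then show ?case using set_tableau_insert[of x "P_tableau w"] unfolding P_tableau_snoc by fastforce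
qed (simp add: P_tableau_def)

lemma reach_equiv_P_tableau: "reach_equiv w (concat (rev (P_tableau w)))"
proof (induction w rule: rev_induct)
  case (snoc x w)
  have "reach_equiv ([] @ w @ [x]) ([] @ concat (rev (P_tableau w)) @ [x])"
    using snoc by (intro reach_equiv_append)
  moreover have "reach_equiv (concat (rev (P_tableau w)) @ [x]) (concat (rev (P_tableau (w @ [x]))))"
    unfolding P_tableau_snoc
    by (intro reach_equiv_tableau_insert tableau_sorted tableau_P_tableau)
  ultimately show ?case using reach_equiv_trans by simp
qed (simp add: P_tableau_def)

section \<open>Relabelling the letters\<close>

text \<open>Insertion depends only on comparisons of letters; this lets the alphabet be replaced by
  \<open>{1..m}\<close>.\<close>

lemma row_insert_map:
  assumes "strict_mono_on A f" "x \<in> A" "set R \<subseteq> A"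
  shows "row_insert (f x) (map f R) = map_prod (map f) (map_option f) (row_insert x R)"
  using assms(3)
  by (induction R) (use assms in \<open>auto split: prod.splits simp: strict_mono_on_less\<close>)

lemma tableau_insert_map:
  assumes "strict_mono_on A f" "x \<in> A" "set (concat T) \<subseteq> A"
  shows "tableau_insert (f x) (map (map f) T) = map_prod (map (map f)) id (tableau_insert x T)"
  using assms(2,3)
proof (induction x T rule: tableau_insert.induct)
  case (2 x R T)
  obtain R' b where Rb: "row_insert x R = (R', b)" by fastforce
  have m: "row_insert (f x) (map f R) = (map f R', map_option f b)"
    using row_insert_map[OF assms(1), of x R] 2 Rb by simp
  show ?case
  proof (cases b)
    case None
    then show ?thesis using Rb m by simp
  next
    case (Some y)
    from row_insert_SomeD Rb Some obtain u v where "R = u @ y # v" by blast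
    then have "tableau_insert (f y) (map (map f) T) = map_prod (map (map f)) id (tableau_insert y T)"
      using 2 Rb Some by (auto simp: id_def)
    then show ?thesis using Rb m Some by (auto split: prod.splits)
  qed
qed simp

lemma P_tableau_map:
  assumes "strict_mono_on A f" "set w \<subseteq> A"
  shows "P_tableau (map f w) = map (map f) (P_tableau w)"
  using assms(2)
proof (induction w rule: rev_induct)
  case (snoc x w)
  then have "tableau_insert (f x) (map (map f) (P_tableau w)) =
      map_prod (map (map f)) id (tableau_insert x (P_tableau w))"
    using set_P_tableau[of w] by (intro tableau_insert_map[OF assms(1)]) auto
  then show ?case using snoc by (simp add: P_tableau_snoc)
qed (simp add: P_tableau_def)

lemma sum_rsk_row_length:
  "(\<Sum>j=1..r. rsk_row_length w j) = sum_list (map length (take r (P_tableau w)))"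
proof -
  have "(\<Sum>j=1..r. if 1 \<le> j \<and> j \<le> length l then l ! (j - 1) else 0) = sum_list (take r l)"
    for l :: "nat list"
  proof (induction r)
    case (Suc r)
    then show ?case by (cases "r < length l") (auto simp: take_Suc_conv_app_nth)
  qed simp
  from this[of "map length (P_tableau w)"] show ?thesis
    unfolding rsk_row_length_def rsk_shape_def tableau_shape_def fst_rsk take_map .
qed


lemma subseq_set_subset: "subseq u v \<Longrightarrow> set u \<subseteq> set v"
  by (auto simp: subseq_conv_nths set_nths)

subsection \<open>Reading words of tableaux\<close>

text \<open>Catching \<open>y\<close> forces the counts below \<open>y\<close> down to at most
  \<open>r - 1\<close>, and all later letters are below \<open>y\<close>, which therefore replaces
  \<open>B\<close>. A nonnegative final count at 0 leaves room for at most \<open>r\<close> such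
  drops.\<close>

lemma decreasing_length_le:
  assumes "sorted_wrt (>) u" "\<forall>y\<in>set u. 0 < y \<and> y < B" "\<forall>t<B. c t \<le> r"
    and "0 < B" "0 \<le> fold bump u c 0"
  shows "int (length u) \<le> r"
  using assms
proof (induction u arbitrary: B c r)
  case Nil
  then show ?case by force
next
  case (Cons y u)
  have "\<forall>t<y. bump y c t \<le> r - 1"
    using Cons.prems by (auto simp: bump_def min_le_iff_disj)
  then have "int (length u) \<le> r - 1"
    using Cons.prems by (intro Cons.IH[of y "bump y c"]) auto
  then show ?case by simp
qed

definition column_height :: "'a list list \<Rightarrow> nat \<Rightarrow> nat" where
  "column_height T j = length (filter (\<lambda>R. j < length R) T)"

lemma tableau_length_le: "tableau (R # T) \<Longrightarrow> S \<in> set T \<Longrightarrow> length S \<le> length R"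
proof (induction T arbitrary: R)
  case (Cons Q T)
  then have "length Q \<le> length R" by (simp add: row_above_def)
  then show ?case using Cons.IH[of Q] Cons.prems by fastforce
qed simp

text \<open>The boxes of the top \<open>r\<close> rows are counted by columns, removing one row at a
  time; equality may fail because \<open>N\<close> may cut off columns.\<close>

lemma sum_min_column_height:
  "tableau T \<Longrightarrow> (\<Sum>j<N. min r (column_height T j)) \<le> sum_list (map length (take r T))"
proof (induction T arbitrary: r)
  case (Cons R T)
  show ?case
  proof (cases r)
    case (Suc q)
    have "min r (column_height (R # T) j) \<le>
        (if j < length R then 1 else 0) + min q (column_height T j)" for j
    proof (cases "j < length R")
      case False
      then have "column_height T j = 0"
        using tableau_length_le[OF Cons.prems] by (force simp: column_height_def filter_empty_conv)
      then show ?thesis using False by (simp add: column_height_def)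
    qed (simp add: Suc column_height_def)
    then have "(\<Sum>j<N. min r (column_height (R # T) j)) \<le>
        (\<Sum>j<N. if j < length R then 1 else 0) + (\<Sum>j<N. min q (column_height T j))"
      by (simp add: sum_mono flip: sum.distrib)
    also have "(\<Sum>j<N. if j < length R then 1 else 0 :: nat) = card ({..<N} \<inter> {j. j < length R})"
      by (simp add: sum.If_cases)
    also have "\<dots> \<le> card {..<length R}"
      by (rule card_mono) auto
    also have "(\<Sum>j<N. min q (column_height T j)) \<le> sum_list (map length (take q T))"
      using Cons by simp
    finally show ?thesis using Suc by simp
  qed simp
qed (simp add: column_height_def)

text \<open>The letters of \<open>v\<close> are distributed over the columns they are taken from. A
  column is read upwards, hence in decreasing order. The lower bound by the top entry of the column
  carries the induction: the entry of a new top row is smaller than all letters collected so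
  far.\<close>

lemma subseq_columns:
  assumes "tableau T" "subseq v (concat (rev T))" "\<forall>R\<in>set T. length R \<le> N"
  shows "\<exists>u. length v = (\<Sum>j<N. length (u j)) \<and>
    (\<forall>j. subseq (u j) v \<and> sorted_wrt (>) (u j) \<and> length (u j) \<le> column_height T j \<and>
      (\<forall>y\<in>set (u j). T \<noteq> [] \<and> j < length (hd T) \<and> hd T ! j \<le> y))"
  using assms
proof (induction T arbitrary: v)
  case Nil
  then show ?case by (intro exI[of _ "\<lambda>_. []"]) (simp add: column_height_def)
next
  case (Cons R T)
  from Cons.prems obtain v1 v2 where v: "v = v1 @ v2" "subseq v1 (concat (rev T))" "subseq v2 R"
    by (auto elim: subseq_appendE)
  obtain J where J: "v2 = nths R J" using v(3) by (auto simp: subseq_conv_nths)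
  obtain u where u: "length v1 = (\<Sum>j<N. length (u j))" "\<And>j. subseq (u j) v1"
      "\<And>j. sorted_wrt (>) (u j)" "\<And>j. length (u j) \<le> column_height T j"
      "\<And>j y. y \<in> set (u j) \<Longrightarrow> T \<noteq> [] \<and> j < length (hd T) \<and> hd T ! j \<le> y"
    using Cons.IH[OF _ v(2)] Cons.prems by auto
  have above: "j < length R \<and> R ! j < y" if "y \<in> set (u j)" for j y
    using u(5)[OF that] Cons.prems(1) by (auto simp: row_above_def intro: less_le_trans)
  \<comment> \<open>Column \<open>j\<close> receives its entry of the top row exactly if
    \<open>v\<close> uses that position; it is read last and goes to the end.\<close>
  define u' where "u' = (\<lambda>j. u j @ (if j < length R \<and> j \<in> J then [R ! j] else []))"
  have "(\<Sum>j<N. length (u' j)) = length v1 + (\<Sum>j<N. if j < length R \<and> j \<in> J then 1 else 0)"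
    unfolding u'_def u(1) sum.distrib[symmetric] by (rule sum.cong) auto
  also have "(\<Sum>j<N. if j < length R \<and> j \<in> J then 1 else 0) = card ({..<N} \<inter> {j. j < length R \<and> j \<in> J})"
    by (simp add: sum.If_cases)
  also have "{..<N} \<inter> {j. j < length R \<and> j \<in> J} = {j. j < length R \<and> j \<in> J}"
    using Cons.prems(3) by auto
  finally have "length v = (\<Sum>j<N. length (u' j))" using v(1) J by (simp add: length_nths)
  moreover have "subseq (u' j) v" for j
    unfolding v(1) u'_def by (intro list_emb_append_mono u) (auto simp: J set_nths subseq_singleton_left)
  moreover have "sorted_wrt (>) (u' j)" for j
    using u(3) above by (auto simp: u'_def sorted_wrt_append)
  moreover have "length (u' j) \<le> column_height (R # T) j" for j
    using u(4)[of j] by (auto simp: u'_def column_height_def)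
  moreover have "\<forall>y\<in>set (u' j). j < length R \<and> R ! j \<le> y" for j
    using above by (auto simp: u'_def split: if_splits) fastforce+
  ultimately show ?case by (intro exI[of _ u']) simp
qed

text \<open>Omitting the catches outside one column only raises the final count at 0, so
  \<open>decreasing_length_le\<close> allows at most \<open>r\<close> letters per column; the height
  of the column is a second bound.\<close>

lemma reading_word_upper_bound:
  assumes "tableau T" "\<forall>y\<in>set (concat T). 0 < y" "subseq v (concat (rev T))"
    and "\<forall>t. c t \<le> int r" "0 \<le> fold bump v c 0"
  shows "length v \<le> sum_list (map length (take r T))"
proof -
  define N where "N = sum_list (map length T)"
  have N: "\<forall>R\<in>set T. length R \<le> N" unfolding N_def by (simp add: member_le_sum_list)
  obtain u where u: "length v = (\<Sum>j<N. length (u j))" "\<And>j. subseq (u j) v"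
      "\<And>j. sorted_wrt (>) (u j)" "\<And>j. length (u j) \<le> column_height T j"
    using subseq_columns[OF assms(1,3) N] by blast
  have "length (u j) \<le> r" for j
  proof -
    have "set (u j) \<subseteq> set (concat T)"
      using u(2)[of j] assms(3) by (auto dest!: subseq_set_subset)
    then have "\<forall>y\<in>set (u j). 0 < y \<and> y < Suc (Max (set (u j)))"
      using assms(2) by (auto simp: less_Suc_eq_le)
    moreover have "0 \<le> fold bump (u j) c 0"
      using fold_bump_subseq[OF u(2)[of j], of c] assms(5) by (force simp: le_fun_def intro: order.trans)
    ultimately show ?thesis
      using decreasing_length_le[OF u(3)[of j], of "Suc (Max (set (u j)))" c "int r"] assms(4) by simp
  qed
  then have "length v \<le> (\<Sum>j<N. min r (column_height T j))"
    unfolding u(1) using u(4) by (intro sum_mono) simp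
  also have "\<dots> \<le> sum_list (map length (take r T))"
    by (rule sum_min_column_height[OF assms(1)])
  finally show ?thesis .
qed

text \<open>Counts of at least \<open>Suc i\<close> from \<open>y\<close> on provide an element
  beyond the \<open>i\<close> smallest for each catch. Catching \<open>z\<close> leaves the counts
  from \<open>z\<close> on unchanged, so sortedness keeps this true for the rest of the row.\<close>

lemma fold_bump_row_ge:
  assumes "sorted R" "set R \<subseteq> {y..m}" "\<forall>t\<ge>y. int (Suc i) \<le> c t"
    and "\<forall>t. int (min t i) \<le> c t" "\<forall>t\<le>m. int (t - d) \<le> c t" "i < y"
  shows "(\<forall>t. int (min t i) \<le> fold bump R c t) \<and> (\<forall>t\<le>m. int (t - d) \<le> fold bump R c t)"
  using assms
proof (induction R arbitrary: c y)
  case (Cons z R)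
  have z: "y \<le> z" "z \<le> m" and cz: "int (Suc i) \<le> c z" "int (z - d) \<le> c z" using Cons.prems by auto
  have "(\<forall>t. int (min t i) \<le> fold bump R (bump z c) t) \<and>
      (\<forall>t\<le>m. int (t - d) \<le> fold bump R (bump z c) t)"
  proof (rule Cons.IH)
    show "\<forall>t\<ge>z. int (Suc i) \<le> bump z c t" using Cons.prems z by (auto simp: bump_def)
    show "\<forall>t. int (min t i) \<le> bump z c t"
      using Cons.prems(4) cz by (auto simp: bump_def)
    show "\<forall>t\<le>m. int (t - d) \<le> bump z c t"
    proof (intro allI impI)
      fix t assume "t \<le> m"
      then have "int (t - d) \<le> c t" using Cons.prems by blast
      \<comment> \<open>For \<open>z \<le> d\<close> the truncated difference is 0, and
        \<open>Suc i \<le> c z\<close> suffices.\<close>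
      moreover have "t < z \<Longrightarrow> int (t - d) \<le> c z - 1" using cz by linarith
      ultimately show "int (t - d) \<le> bump z c t" by (simp add: bump_def)
    qed
  qed (use Cons.prems z in auto)
  then show ?case by simp
qed simp

text \<open>Reading the row of index \<open>i\<close> weakens the guaranteed count from
  \<open>min t (Suc i)\<close> to \<open>min t i\<close>, which is exactly what the row above it
  needs.\<close>

lemma fold_bump_rows_ge:
  assumes "\<forall>i<length T. sorted (T ! i) \<and> set (T ! i) \<subseteq> {Suc i..m}"
    and "\<forall>t. int (min t (length T)) \<le> c t" "\<forall>t\<le>m. int (t - d) \<le> c t"
  shows "\<forall>t\<le>m. int (t - d) \<le> fold bump (concat (rev T)) c t"
  using assms
proof (induction T arbitrary: c rule: rev_induct)
  case (snoc R T)
  have R: "sorted R" "set R \<subseteq> {Suc (length T)..m}"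
    using snoc.prems(1)[rule_format, of "length T"] by auto
  have "(\<forall>t. int (min t (length T)) \<le> fold bump R c t) \<and> (\<forall>t\<le>m. int (t - d) \<le> fold bump R c t)"
  proof (rule fold_bump_row_ge[OF R])
    have *: "int (min t (Suc (length T))) \<le> c t" for t using snoc.prems(2) by simp
    show "\<forall>t\<ge>Suc (length T). int (Suc (length T)) \<le> c t"
      using * by (metis min.absorb2)
    show "\<forall>t. int (min t (length T)) \<le> c t"
    proof
      fix t
      have "min t (length T) \<le> min t (Suc (length T))" by simp
      then show "int (min t (length T)) \<le> c t" using *[of t] by linarith
    qed
  qed (use snoc.prems in auto)
  moreover have "\<forall>i<length T. sorted (T ! i) \<and> set (T ! i) \<subseteq> {Suc i..m}"
  proof (intro allI impI)
    fix i assume i: "i < length T"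
    show "sorted (T ! i) \<and> set (T ! i) \<subseteq> {Suc i..m}"
      using snoc.prems(1)[rule_format, of i] i by (simp add: nth_append)
  qed
  ultimately show ?case using snoc.IH by simp
qed simp

text \<open>Each step down a column raises the entry by at least one.\<close>

lemma tableau_row_ge:
  assumes "tableau (R # T)" "\<forall>y\<in>set R. i < y" "j \<le> length T" "y \<in> set ((R # T) ! j)"
  shows "i + j < y"
  using assms
proof (induction T arbitrary: R i j)
  case (Cons Q T)
  show ?case
  proof (cases j)
    case (Suc k)
    have "Suc i < Q ! p" if "p < length Q" for p
    proof -
      have "R ! p < Q ! p" "p < length R" using that Cons.prems(1) by (auto simp: row_above_def)
      then show ?thesis using Cons.prems(2) by (metis less_trans_Suc nth_mem)
    qed
    then have "\<forall>y\<in>set Q. Suc i < y" by (metis in_set_conv_nth)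
    then show ?thesis using Cons.IH[of Q "Suc i" k] Cons.prems Suc by simp
  qed (use Cons in simp)
qed simp

subsection \<open>Arrays and subsequences\<close>

lemma card_filter_eq_sum: "finite A \<Longrightarrow> card {x \<in> A. P x} = (\<Sum>x\<in>A. if P x then 1 else 0)"
  by (simp add: sum.If_cases Int_def)

text \<open>\<open>L t\<close> is the letter read at time \<open>t\<close>; the hits are the paths
  that carry this letter at that time and so catch it.\<close>

definition array_hits :: "(nat \<Rightarrow> nat) \<Rightarrow> nat \<Rightarrow> (nat \<Rightarrow> nat \<Rightarrow> nat) \<Rightarrow> nat \<Rightarrow> nat set" where
  "array_hits L r k t = {j \<in> {1..r}. k j (L t - 1) < t \<and> t \<le> k j (L t)}"

lemma J_arraysD:
  assumes "k \<in> J_arrays n r m" "j \<in> {1..r}"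
  shows "l < j \<Longrightarrow> k j l = 0"
    and "m - r + j \<le> l \<Longrightarrow> l \<le> m \<Longrightarrow> k j l = n"
    and "l < m \<Longrightarrow> k j l \<le> k j (Suc l)"
    and "j < r \<Longrightarrow> l < m \<Longrightarrow> k (Suc j) (Suc l) \<le> k j l"
proof -
  have 1: "\<forall>j\<in>{1..r}. \<forall>l\<in>{0..j - 1}. k j l = 0"
    and 2: "\<forall>j\<in>{1..r}. \<forall>l\<in>{m - r + j..m}. k j l = n"
    and 3: "\<forall>j\<in>{1..r}. \<forall>l\<in>{1..m}. k j (l - 1) \<le> k j l"
    and 4: "\<forall>j\<in>{1..r - 1}. \<forall>l\<in>{0..m - 1}. k (j + 1) (l + 1) \<le> k j l"
    using assms(1) unfolding J_arrays_def by blast+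
  show "l < j \<Longrightarrow> k j l = 0" using 1 assms(2) by auto
  show "m - r + j \<le> l \<Longrightarrow> l \<le> m \<Longrightarrow> k j l = n" using 2 assms(2) by auto
  show "l < m \<Longrightarrow> k j l \<le> k j (Suc l)" using 3[rule_format, of j "Suc l"] assms(2) by auto
  show "j < r \<Longrightarrow> l < m \<Longrightarrow> k (Suc j) (Suc l) \<le> k j l"
    using 4[rule_format, of j l] assms(2) by auto
qed

lemma J_arrays_mono:
  assumes "k \<in> J_arrays n r m" "j \<in> {1..r}" "l \<le> l'" "l' \<le> m"
  shows "k j l \<le> k j l'"
  using assms(3,4)
proof (induction l' rule: dec_induct)
  case (step l')
  then show ?case using J_arraysD(3)[OF assms(1,2), of l'] by simp
qed simp

lemma J_arrays_antimono:
  assumes "k \<in> J_arrays n r m" "1 \<le> j" "j \<le> j'" "j' \<le> r" "l \<le> m"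
  shows "k j' l \<le> k j l"
  using assms(3,4)
proof (induction j' rule: dec_induct)
  case (step i)
  have i: "i \<in> {1..r}" using step assms(2) by auto
  have "k (Suc i) l \<le> k i l"
  proof (cases l)
    case 0
    then show ?thesis using J_arraysD(1)[OF assms(1), of "Suc i" 0] step by auto
  next
    case (Suc l0)
    then have "k (Suc i) l \<le> k i l0" using J_arraysD(4)[OF assms(1) i, of l0] step assms(5) by auto
    also have "\<dots> \<le> k i l" using J_arrays_mono[OF assms(1) i] Suc assms(5) by auto
    finally show ?thesis .
  qed
  then show ?case using step by simp
qed simp

text \<open>The interlacing conditions say that at each time the \<open>r\<close> paths carry distinct letters.\<close>

lemma card_array_hits_le:
  assumes k: "k \<in> J_arrays n r m" and L: "L t \<in> {1..m}"
  shows "card (array_hits L r k t) \<le> 1"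
proof -
  have False if "j \<in> array_hits L r k t" "j' \<in> array_hits L r k t" "j < j'" for j j'
  proof -
    have j: "j \<in> {1..r}" "k j (L t - 1) < t" "j' \<le> r" "t \<le> k j' (L t)"
      using that by (auto simp: array_hits_def)
    have "k j' (L t) \<le> k (Suc j) (L t)"
      using J_arrays_antimono[OF k, of "Suc j" j' "L t"] that(3) j L by auto
    also have "\<dots> \<le> k j (L t - 1)"
      using J_arraysD(4)[OF k j(1), of "L t - 1"] that(3) j L by auto
    finally show False using j by simp
  qed
  then have "\<forall>j\<in>array_hits L r k t. \<forall>j'\<in>array_hits L r k t. j = j'"
    by (metis linorder_neqE_nat)
  then show ?thesis by (simp add: card_le_Suc0_iff_eq array_hits_def)
qed

text \<open>Each difference counts the times in the interval of path \<open>j\<close> and letter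
  \<open>l\<close> at which \<open>l\<close> is read; exchanging the sums over paths and times gives
  the hits.\<close>

lemma array_weight_eq:
  fixes L :: "nat \<Rightarrow> nat"
  defines "occ \<equiv> \<lambda>l q. card {i \<in> {1..q}. L i = l}"
  assumes k: "k \<in> J_arrays n r m" and L: "\<forall>i\<in>{1..n}. L i \<in> {1..m}" and r: "r \<le> m"
  shows "(\<Sum>j=1..r. \<Sum>l=j..m - r + j. int (occ l (k j l)) - int (occ l (k j (l - 1)))) =
    int (\<Sum>t=1..n. card (array_hits L r k t))"
proof -
  let ?D = "\<lambda>j l. {t \<in> {1..n}. L t = l \<and> k j (l - 1) < t \<and> t \<le> k j l}"
  have D: "int (occ l (k j l)) - int (occ l (k j (l - 1))) = int (card (?D j l))"
    if j: "j \<in> {1..r}" and l: "l \<in> {1..m}" for j l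
  proof -
    have le: "k j (l - 1) \<le> k j l" using J_arrays_mono[OF k j] l by simp
    have "k j l \<le> n" using J_arrays_le[OF k j _ r] l by simp
    then have "{i \<in> {1..k j l}. L i = l} = {i \<in> {1..k j (l - 1)}. L i = l} \<union> ?D j l"
      using le by auto
    moreover have "card ({i \<in> {1..k j (l - 1)}. L i = l} \<union> ?D j l) =
        card {i \<in> {1..k j (l - 1)}. L i = l} + card (?D j l)"
      by (rule card_Un_disjoint) auto
    ultimately show ?thesis by (simp add: occ_def)
  qed
  have "(\<Sum>l=j..m - r + j. int (occ l (k j l)) - int (occ l (k j (l - 1)))) =
      int (card {t \<in> {1..n}. j \<in> array_hits L r k t})" if j: "j \<in> {1..r}" for j
  proof -
    \<comment> \<open>Outside this range of \<open>l\<close> the boundary values 0 and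
      \<open>n\<close> make \<open>k j (l - 1)\<close> and \<open>k j l\<close> equal, so all
      letters may be included.\<close>
    have "(\<Sum>l=j..m - r + j. int (occ l (k j l)) - int (occ l (k j (l - 1)))) =
        (\<Sum>l=1..m. int (occ l (k j l)) - int (occ l (k j (l - 1))))"
    proof (rule sum.mono_neutral_left)
      show "{j..m - r + j} \<subseteq> {1..m}" using j r by auto
      show "\<forall>l\<in>{1..m} - {j..m - r + j}. int (occ l (k j l)) - int (occ l (k j (l - 1))) = 0"
      proof
        fix l assume l: "l \<in> {1..m} - {j..m - r + j}"
        then consider "l < j" | "m - r + j < l" by auto
        then have "k j l = k j (l - 1)"
        proof cases
          case 1
          then show ?thesis using J_arraysD(1)[OF k j] by simp
        next
          case 2
          then show ?thesis using J_arraysD(2)[OF k j] l by simp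
        qed
        then show "int (occ l (k j l)) - int (occ l (k j (l - 1))) = 0" by simp
      qed
    qed simp
    also have "\<dots> = int (\<Sum>l=1..m. card (?D j l))" using D j by simp
    also have "(\<Sum>l=1..m. card (?D j l)) = card (\<Union>l\<in>{1..m}. ?D j l)"
      by (rule card_UN_disjoint[symmetric]) auto
    also have "(\<Union>l\<in>{1..m}. ?D j l) = {t \<in> {1..n}. j \<in> array_hits L r k t}"
      using L j by (auto simp: array_hits_def)
    finally show ?thesis .
  qed
  then have "(\<Sum>j=1..r. \<Sum>l=j..m - r + j. int (occ l (k j l)) - int (occ l (k j (l - 1)))) =
      int (\<Sum>j=1..r. card {t \<in> {1..n}. j \<in> array_hits L r k t})"
    by simp
  also have "(\<Sum>j=1..r. card {t \<in> {1..n}. j \<in> array_hits L r k t}) =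
      (\<Sum>j=1..r. \<Sum>t=1..n. if j \<in> array_hits L r k t then 1 else 0)"
    by (intro sum.cong card_filter_eq_sum) auto
  also have "\<dots> = (\<Sum>t=1..n. \<Sum>j=1..r. if j \<in> array_hits L r k t then 1 else 0)"
    by (rule sum.swap)
  also have "\<dots> = (\<Sum>t=1..n. card {j \<in> {1..r}. j \<in> array_hits L r k t})"
    by (intro sum.cong card_filter_eq_sum[symmetric]) auto
  also have "\<dots> = (\<Sum>t=1..n. card (array_hits L r k t))"
    by (intro sum.cong arg_cong[where f = card]) (auto simp: array_hits_def)
  finally show ?thesis .
qed

section \<open>Passing between arrays and caught subsequences\<close>

lemma nths_take_Suc:
  assumes "i < length w"
  shows "nths (take (Suc i) w) I = nths (take i w) I @ (if i \<in> I then [w ! i] else [])"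
  using assms by (simp add: take_Suc_conv_app_nth nths_append)

text \<open>The set counted by \<open>C i l\<close> consists of the paths that carry a letter at most \<open>l\<close> at
  time \<open>i\<close>; the clause \<open>j \<le> l\<close> only matters for \<open>i = 0\<close>.\<close>

lemma subseq_of_array:
  assumes k: "k \<in> J_arrays n r m" and L: "\<forall>i\<in>{1..n}. L i \<in> {1..m}" and r: "r \<le> m"
  obtains v where "subseq v (map L [1..<Suc n])"
    "(\<Sum>t=1..n. card (array_hits L r k t)) \<le> length v"
    "\<forall>l\<le>m. int (l - (m - r)) \<le> fold bump v (\<lambda>t. int (min t r)) l"
proof -
  let ?w = "map L [1..<Suc n]"
  define C where "C i l = {j \<in> {1..r}. i \<le> k j l \<and> j \<le> l}" for i l
  \<comment> \<open>List positions start at 0: position \<open>i\<close> belongs to time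
    \<open>Suc i\<close>.\<close>
  define I where "I = {i. array_hits L r k (Suc i) \<noteq> {}}"
  define s where "s i = fold bump (nths (take i ?w) I) (\<lambda>t. int (min t r))" for i
  have fin: "finite (C i l)" for i l by (simp add: C_def)
  have nth: "?w ! i = L (Suc i)" if "i < n" for i using that by (simp del: upt_Suc)
  have C_mono: "C (Suc i) l \<subseteq> C i l" for i l by (auto simp: C_def)
  \<comment> \<open>The greedy chain is the least one: its counts are at least those of the chain
    given by the array.\<close>
  have ge: "\<forall>l\<le>m. int (card (C i l)) \<le> s i l" if "i \<le> n" for i
    using that
  proof (induction i)
    case 0
    have "C 0 l = {1..min l r}" for l by (auto simp: C_def)
    then show ?case by (simp add: s_def)
  next
    case (Suc i)
    then have IH: "int (card (C i l)) \<le> s i l" if "l \<le> m" for l using that by simp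
    have le: "int (card (C (Suc i) l)) \<le> s i l" if "l \<le> m" for l
      using IH[OF that] card_mono[OF fin C_mono, of i l] by linarith
    show ?case
    proof (cases "i \<in> I")
      case False
      then have "s (Suc i) = s i" using Suc.prems by (simp add: s_def nths_take_Suc del: upt_Suc)
      then show ?thesis using le by simp
    next
      case True
      define x where "x = L (Suc i)"
      have x: "x \<in> {1..m}" using L Suc.prems by (simp add: x_def)
      have s: "s (Suc i) = bump x (s i)"
        using True Suc.prems nth[of i] by (simp add: s_def nths_take_Suc x_def del: upt_Suc)
      obtain j where j: "j \<in> {1..r}" "k j (x - 1) < Suc i" "Suc i \<le> k j x"
        using True by (auto simp: I_def array_hits_def x_def)
      \<comment> \<open>Path \<open>j\<close> carries \<open>x\<close> at time \<open>Suc i\<close>: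
        it is counted at \<open>x\<close> but not below, which pays for the \<open>- 1\<close> in
        \<open>bump\<close>.\<close>
      have lt: "int (card (C (Suc i) l)) \<le> s i x - 1" if l: "l < x" for l
      proof -
        have sub: "C (Suc i) l \<subseteq> C (Suc i) x"
        proof
          fix p assume "p \<in> C (Suc i) l"
          then show "p \<in> C (Suc i) x"
            using J_arrays_mono[OF k, of p l x] l x by (auto simp: C_def)
        qed
        have "j \<le> x" using J_arraysD(1)[OF k j(1), of x] j(3) by (cases "x < j") auto
        then have "j \<in> C (Suc i) x" using j by (simp add: C_def)
        moreover have "j \<notin> C (Suc i) l"
        proof -
          have "l \<le> x - 1" "x - 1 \<le> m" using l x by auto
          then show ?thesis using J_arrays_mono[OF k j(1), of l "x - 1"] j(2) by (auto simp: C_def)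
        qed
        ultimately have "card (C (Suc i) l) < card (C (Suc i) x)"
          using sub by (intro psubset_card_mono fin) blast
        then show ?thesis using le[of x] x by simp
      qed
      show ?thesis using le lt by (auto simp: s bump_def)
    qed
  qed
  show ?thesis
  proof
    show "subseq (nths ?w I) ?w" by (auto simp: subseq_conv_nths)
    have "(\<Sum>t=1..n. card (array_hits L r k t)) \<le>
        (\<Sum>t=1..n. if array_hits L r k t \<noteq> {} then 1 else 0)"
      using card_array_hits_le[OF k] L by (intro sum_mono) auto
    also have "\<dots> = card {t \<in> {1..n}. array_hits L r k t \<noteq> {}}"
      by (rule card_filter_eq_sum[symmetric]) simp
    also have "\<dots> = card (Suc ` {i. i < n \<and> i \<in> I})"
      by (rule arg_cong[where f = card]) (auto simp: I_def image_iff Suc_le_eq gr0_conv_Suc)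
    also have "\<dots> = length (nths ?w I)" by (simp add: length_nths card_image del: upt_Suc)
    finally show "(\<Sum>t=1..n. card (array_hits L r k t)) \<le> length (nths ?w I)" .
    show "\<forall>l\<le>m. int (l - (m - r)) \<le> fold bump (nths ?w I) (\<lambda>t. int (min t r)) l"
    proof (intro allI impI)
      fix l assume l: "l \<le> m"
      \<comment> \<open>The boundary value \<open>n\<close> places path \<open>j\<close> at a letter
        at most \<open>m - r + j\<close> at time \<open>n\<close>.\<close>
      have "{1..l - (m - r)} \<subseteq> C n l"
      proof
        fix j assume j: "j \<in> {1..l - (m - r)}"
        then have "j \<in> {1..r}" "m - r + j \<le> l" using l r by auto
        then show "j \<in> C n l" using J_arraysD(2)[OF k, of j l] l by (simp add: C_def)
      qed
      then have "l - (m - r) \<le> card (C n l)"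
        using card_mono[OF fin, of "{1..l - (m - r)}" n l] by simp
      also have "int \<dots> \<le> s n l" using ge l by simp
      finally show "int (l - (m - r)) \<le> fold bump (nths ?w I) (\<lambda>t. int (min t r)) l"
        by (simp add: s_def del: upt_Suc)
    qed
  qed
qed

text \<open>A counting function grows by at most one per letter; along the chain this yields the
  interlacing condition of \<open>J_arrays\<close>.\<close>

lemma fold_bump_lipschitz:
  assumes "\<forall>t. c (Suc t) \<le> c t + 1"
  shows "fold bump v c (Suc t) \<le> fold bump v c t + 1"
  using assms
proof (induction v arbitrary: c)
  case (Cons x v)
  have "bump x c (Suc t) \<le> bump x c t + 1" for t
    using Cons.prems[rule_format, of t] by (cases "Suc t = x") (auto simp: bump_def)
  then show ?case using Cons.IH by simp
qed simp

text \<open>Path \<open>j\<close> follows the \<open>j\<close>-th smallest element of the sets: \<open>k j l\<close> is the last time at which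
  at least \<open>j\<close> elements are \<open>\<le> l\<close>.\<close>

lemma array_of_subseq:
  assumes v: "subseq v (map L [1..<Suc n])" and L: "\<forall>i\<in>{1..n}. L i \<in> {1..m}" and r: "r \<le> m"
    and b: "\<forall>l\<le>m. int (l - (m - r)) \<le> fold bump v (\<lambda>t. int (min t r)) l"
  obtains k where "k \<in> J_arrays n r m" "length v \<le> (\<Sum>t=1..n. card (array_hits L r k t))"
proof -
  let ?w = "map L [1..<Suc n]"
  obtain I where I: "v = nths ?w I" using v by (auto simp: subseq_conv_nths simp del: upt_Suc)
  define s where "s i = fold bump (nths (take i ?w) I) (\<lambda>t. int (min t r))" for i
  have nth: "?w ! i = L (Suc i)" if "i < n" for i using that by (simp del: upt_Suc)
  have s0: "s 0 l = int (min l r)" for l by (simp add: s_def)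
  have sn: "int (l - (m - r)) \<le> s n l" if "l \<le> m" for l
    using b that by (simp add: s_def I del: upt_Suc)
  have s_Suc: "s (Suc i) = (if i \<in> I then bump (L (Suc i)) (s i) else s i)" if "i < n" for i
    using that nth[OF that] by (simp add: s_def nths_take_Suc del: upt_Suc)
  have s_anti: "s i' l \<le> s i l" if "i \<le> i'" "i' \<le> n" for i i' l
    using that
  proof (induction i' rule: dec_induct)
    case (step i')
    have "s (Suc i') l \<le> s i' l"
      using s_Suc[of i'] step bump_le[of "L (Suc i')" "s i'"] by (auto simp: le_fun_def)
    then show ?case using step by simp
  qed simp
  have s_mono: "s i l \<le> s i l'" if "l \<le> l'" for i l l'
    using that unfolding s_def by (intro monoD[OF mono_fold_bump] monoI) auto
  have s_lip: "s i (Suc l) \<le> s i l + 1" for i l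
    unfolding s_def by (rule fold_bump_lipschitz) auto
  \<comment> \<open>Counts decrease in time, so the counted times form an initial segment and their
    number is the last of them, or 0 if there is none.\<close>
  define K where "K j l = card {i \<in> {1..n}. int j \<le> s i l}" for j l
  have K_iff: "t \<le> K j l \<longleftrightarrow> int j \<le> s t l" if t: "t \<in> {1..n}" for t j l
  proof
    assume "int j \<le> s t l"
    then have "{1..t} \<subseteq> {i \<in> {1..n}. int j \<le> s i l}"
      using s_anti[of _ t l] t by (force intro: order.trans)
    then have "card {1..t} \<le> K j l" unfolding K_def by (intro card_mono) auto
    then show "t \<le> K j l" by simp
  next
    assume le: "t \<le> K j l"
    show "int j \<le> s t l"
    proof (rule ccontr)
      assume "\<not> ?thesis"
      then have "{i \<in> {1..n}. int j \<le> s i l} \<subseteq> {1..<t}"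
        using s_anti[of t _ l] by (force simp: not_le[symmetric])
      then have "K j l \<le> card {1..<t}" unfolding K_def by (intro card_mono) auto
      then show False using le t by auto
    qed
  qed
  define k where "k = (\<lambda>j\<in>{1..r}. \<lambda>l\<in>{0..m}. K j l)"
  have kK: "k j l = K j l" if "j \<in> {1..r}" "l \<le> m" for j l using that by (simp add: k_def)
  have K_n: "K j l \<le> n" for j l unfolding K_def by (rule order.trans[OF card_mono[of "{1..n}"]]) auto
  \<comment> \<open>The array conditions \<open>K1\<close> to \<open>K4\<close> come from the start
    set \<open>{1..r}\<close>, the final bound \<open>b\<close>, monotone counts, and increments of
    at most one, respectively.\<close>
  have K1: "K j l = 0" if "l < j" for j l
  proof -
    have "\<not> int j \<le> s i l" if "i \<in> {1..n}" for i
      using s_anti[of 0 i l] s0[of l] that \<open>l < j\<close> by auto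
    then show ?thesis by (simp add: K_def)
  qed
  have K2: "K j l = n" if "m - r + j \<le> l" "l \<le> m" for j l
  proof -
    have "int j \<le> s i l" if "i \<in> {1..n}" for i
    proof -
      have "s n l \<le> s i l" using that by (intro s_anti) auto
      then show ?thesis using sn[OF \<open>l \<le> m\<close>] \<open>m - r + j \<le> l\<close> by linarith
    qed
    then have "{i \<in> {1..n}. int j \<le> s i l} = {1..n}" by auto
    then show ?thesis by (simp add: K_def)
  qed
  have K3: "K j l \<le> K j l'" if "l \<le> l'" for j l l'
    unfolding K_def using s_mono[OF that] by (intro card_mono) (auto intro: order.trans)
  have K4: "K (Suc j) (Suc l) \<le> K j l" for j l
  proof -
    have "int j \<le> s i l" if "int (Suc j) \<le> s i (Suc l)" for i using that s_lip[of i l] by simp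
    then show ?thesis unfolding K_def by (intro card_mono) auto
  qed
  have kJ: "k \<in> J_arrays n r m"
    unfolding J_arrays_def
  proof (intro CollectI conjI ballI)
    show "k \<in> {1..r} \<rightarrow>\<^sub>E ({0..m} \<rightarrow>\<^sub>E UNIV)" by (auto simp: k_def)
  next
    fix j l assume "j \<in> {1..r}" "l \<in> {0..j - 1}"
    then show "k j l = 0" using K1[of l j] r kK[of j l] by auto
  next
    fix j l assume "j \<in> {1..r}" "l \<in> {m - r + j..m}"
    then show "k j l = n" using K2[of j l] kK[of j l] by auto
  next
    fix j l assume "j \<in> {1..r}" "l \<in> {1..m}"
    then show "k j (l - 1) \<le> k j l" using K3[of "l - 1" l j] kK[of j l] kK[of j "l - 1"] by auto
  next
    fix j l assume j: "j \<in> {1..r - 1}" and l: "l \<in> {0..m - 1}"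
    then have "j \<in> {1..r}" "Suc j \<in> {1..r}" "l \<le> m" "Suc l \<le> m" using r by auto
    then show "k (j + 1) (l + 1) \<le> k j l" using K4[of j l] kK[of j l] kK[of "Suc j" "Suc l"] by simp
  qed
  have hit: "1 \<le> card (array_hits L r k (Suc i))" if i: "i < n" "i \<in> I" for i
  proof -
    define x where "x = L (Suc i)"
    have x: "x \<in> {1..m}" using L i by (simp add: x_def)
    have s: "s (Suc i) = bump x (s i)" using s_Suc i by (simp add: x_def)
    have lt: "s (Suc i) (x - 1) < s (Suc i) x" using x by (auto simp: s bump_def)
    have "0 \<le> s n (x - 1)" using sn[of "x - 1"] x by (intro order.trans[OF _ sn]) auto
    also have "\<dots> \<le> s (Suc i) (x - 1)" using i by (intro s_anti) auto
    finally have pos: "0 \<le> s (Suc i) (x - 1)" .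
    \<comment> \<open>The caught element now sits at \<open>x\<close> and its rank is the count
      there. The rank is positive because the final bound keeps earlier counts nonnegative, and at
      most \<open>r\<close> because counts decrease in time.\<close>
    define j where "j = nat (s (Suc i) x)"
    have j: "int j = s (Suc i) x" using lt pos by (simp add: j_def)
    have "s (Suc i) x \<le> s 0 x" using i by (intro s_anti) auto
    then have jr: "j \<in> {1..r}" using j lt pos s0[of x] by auto
    have "Suc i \<le> k j x" "\<not> Suc i \<le> k j (x - 1)"
      using K_iff[of "Suc i" j] kK[OF jr] x i j lt by auto
    then have "j \<in> array_hits L r k (Suc i)" using jr by (simp add: array_hits_def x_def)
    then have "array_hits L r k (Suc i) \<noteq> {}" "finite (array_hits L r k (Suc i))"
      by (auto simp: array_hits_def)
    then show ?thesis by (simp add: Suc_le_eq card_gt_0_iff)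
  qed
  have "length v = card {i \<in> {..<n}. i \<in> I}" by (simp add: I length_nths del: upt_Suc)
  also have "\<dots> = (\<Sum>i<n. if i \<in> I then 1 else 0)" by (rule card_filter_eq_sum) simp
  also have "\<dots> \<le> (\<Sum>i<n. card (array_hits L r k (Suc i)))" using hit by (intro sum_mono) auto
  also have "\<dots> = (\<Sum>t=1..n. card (array_hits L r k t))"
    by (rule sum.reindex_bij_witness[of _ "\<lambda>t. t - 1" Suc]) auto
  finally show ?thesis using that kJ by blast
qed

section \<open>Catching the top rows, and the maximum\<close>

text \<open>The truncated difference is the count for the last set \<open>{m - r + 1..m}\<close>.
  Strict columns put the letters of the row of index \<open>i\<close> above \<open>i\<close>, so the
  rows can be caught starting from \<open>{1..r}\<close>.\<close>

lemma reading_word_lower_bound: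
  assumes T: "tableau T" "set (concat T) \<subseteq> {1..m}" and r: "r \<le> m"
  shows "\<forall>t\<le>m. int (t - (m - r)) \<le> fold bump (concat (rev (take r T))) (\<lambda>t. int (min t r)) t"
proof (rule fold_bump_rows_ge)
  show "\<forall>i<length (take r T). sorted (take r T ! i) \<and> set (take r T ! i) \<subseteq> {Suc i..m}"
  proof (intro allI impI conjI subsetI)
    fix i assume "i < length (take r T)"
    then have i: "i < length T" "take r T ! i = T ! i" by auto
    then have mem: "T ! i \<in> set T" by simp
    show "sorted (take r T ! i)" using tableau_sorted[OF T(1)] mem i(2) by simp
    fix y assume y: "y \<in> set (take r T ! i)"
    obtain R T' where RT: "T = R # T'" using i by (cases T) auto
    have "\<forall>y\<in>set R. 0 < y" using T(2) RT by auto
    then have "0 + i < y"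
      by (rule tableau_row_ge[OF T(1)[unfolded RT]]) (use RT i y in auto)
    moreover have "y \<le> m" using T(2) mem y i(2) by auto
    ultimately show "y \<in> {Suc i..m}" by simp
  qed
qed (use r in auto)

text \<open>The equivalence of word and reading word serves in both directions: towards the reading
  word for the upper bound, and back for an array that attains it.\<close>

lemma sum_rows_eq_Max_arrays:
  assumes L: "\<forall>i\<in>{1..n}. L i \<in> {1..m}" and r: "r \<le> m"
  shows "sum_list (map length (take r (P_tableau (map L [1..<Suc n])))) =
    Max ((\<lambda>k. \<Sum>t=1..n. card (array_hits L r k t)) ` J_arrays n r m)"
proof -
  define w where "w = map L [1..<Suc n]"
  define T where "T = P_tableau w"
  define N where "N = sum_list (map length (take r T))"
  define c0 where "c0 = (\<lambda>t. int (min t r))"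
  have c0: "mono c0" by (auto simp: c0_def mono_def)
  have T: "tableau T" unfolding T_def by (rule tableau_P_tableau)
  have setT: "set (concat T) \<subseteq> {1..m}"
    using set_P_tableau[of w] L by (auto simp: T_def w_def simp del: set_concat)
  have equiv: "reach_equiv w (concat (rev T))" unfolding T_def by (rule reach_equiv_P_tableau)
  have upper: "(\<Sum>t=1..n. card (array_hits L r k t)) \<le> N" if k: "k \<in> J_arrays n r m" for k
  proof -
    obtain v where v: "subseq v w" "(\<Sum>t=1..n. card (array_hits L r k t)) \<le> length v"
        "\<forall>l\<le>m. int (l - (m - r)) \<le> fold bump v c0 l"
      using subseq_of_array[OF k L r] unfolding w_def c0_def by blast
    obtain v' where v': "subseq v' (concat (rev T))" "length v' = length v"
        "fold bump v c0 \<le> fold bump v' c0"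
      using equiv c0 v(1) unfolding reach_equiv_def dominated_def by blast
    have "0 \<le> fold bump v c0 0" using v(3) by force
    also have "\<dots> \<le> fold bump v' c0 0" using v'(3) by (simp add: le_fun_def)
    finally have "length v' \<le> N"
      unfolding N_def by (intro reading_word_upper_bound[OF T _ v'(1)]) (use setT in \<open>auto simp: c0_def\<close>)
    then show ?thesis using v(2) v'(2) by simp
  qed
  define v' where "v' = concat (rev (take r T))"
  \<comment> \<open>The bottom row is read first, so the top \<open>r\<close> rows form a
    suffix.\<close>
  have "concat (rev T) = concat (rev (drop r T)) @ v'"
    unfolding v'_def by (metis append_take_drop_id concat_append rev_append)
  then have "subseq v' (concat (rev T))" by (simp add: subseq_drop_many)
  then obtain v where v: "subseq v w" "length v = length v'" "fold bump v' c0 \<le> fold bump v c0"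
    using equiv c0 unfolding reach_equiv_def dominated_def by blast
  have "\<forall>t\<le>m. int (t - (m - r)) \<le> fold bump v c0 t"
    using reading_word_lower_bound[OF T setT r] v(3)
    unfolding v'_def c0_def le_fun_def by (blast intro: order.trans)
  then obtain k where k: "k \<in> J_arrays n r m" "length v \<le> (\<Sum>t=1..n. card (array_hits L r k t))"
    using array_of_subseq[of v L n m r] v(1) L r unfolding w_def c0_def by blast
  have "length v = N" using v(2)
    by (simp add: v'_def N_def length_concat flip: rev_map)
  then have "(\<Sum>t=1..n. card (array_hits L r k t)) = N" using k upper[OF k(1)] by simp
  then have "N = Max ((\<lambda>k. \<Sum>t=1..n. card (array_hits L r k t)) ` J_arrays n r m)"
    using k(1) upper finite_J_arrays[OF r, of n] by (intro Max_eqI[symmetric]) auto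
  then show ?thesis unfolding N_def T_def w_def .
qed

section \<open>Transfer to an arbitrary totally ordered alphabet\<close>

theorem theorem3p1:
  fixes \<alpha> :: "nat \<Rightarrow> 'a::linorder" and X :: "nat \<Rightarrow> 'a" and m n r :: nat
  assumes "strict_mono_on {1..m} \<alpha>"
    and "\<forall>i\<in>{1..n}. X i \<in> \<alpha> ` {1..m}"
    and "1 \<le> r" and "r \<le> m"
  shows "int (\<Sum>j=1..r. rsk_row_length (map X [1..<Suc n]) j) =
    Max ((\<lambda>k. \<Sum>j=1..r. \<Sum>l=j..m - r + j.
            int (occurrences X \<alpha> l (k j l)) - int (occurrences X \<alpha> l (k j (l - 1))))
         ` J_arrays n r m)"
proof -
  have inj: "inj_on \<alpha> {1..m}" using assms(1) by (rule strict_mono_on_imp_inj_on)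
  \<comment> \<open>Letters are replaced by their indices; as \<open>\<alpha>\<close> is strictly
    increasing, the insertion tableau keeps its shape.\<close>
  define L where "L i = inv_into {1..m} \<alpha> (X i)" for i
  have L: "\<forall>i\<in>{1..n}. L i \<in> {1..m}" unfolding L_def using assms(2) by (blast intro: inv_into_into)
  have X: "X i = \<alpha> (L i)" if "i \<in> {1..n}" for i
    using assms(2) that by (simp add: L_def f_inv_into_f)
  have "map X [1..<Suc n] = map \<alpha> (map L [1..<Suc n])" using X by (auto simp del: upt_Suc)
  moreover have "set (map L [1..<Suc n]) \<subseteq> {1..m}" using L by (auto simp del: upt_Suc)
  ultimately have "P_tableau (map X [1..<Suc n]) = map (map \<alpha>) (P_tableau (map L [1..<Suc n]))"
    by (simp only: P_tableau_map[OF assms(1)])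
  then have rows: "(\<Sum>j=1..r. rsk_row_length (map X [1..<Suc n]) j) =
      sum_list (map length (take r (P_tableau (map L [1..<Suc n]))))"
    unfolding sum_rsk_row_length by (simp add: take_map comp_def del: upt_Suc)
  have occ: "occurrences X \<alpha> l q = card {i \<in> {1..q}. L i = l}" if "l \<in> {1..m}" "q \<le> n" for l q
  proof -
    have "X i = \<alpha> l \<longleftrightarrow> L i = l" if "i \<in> {1..q}" for i
      using X[of i] L inj_on_eq_iff[OF inj, of "L i" l] \<open>l \<in> {1..m}\<close> \<open>q \<le> n\<close> that by auto
    then show ?thesis unfolding occurrences_def by (intro arg_cong[where f = card]) auto
  qed
  let ?f = "\<lambda>k. \<Sum>j=1..r. \<Sum>l=j..m - r + j.
            int (occurrences X \<alpha> l (k j l)) - int (occurrences X \<alpha> l (k j (l - 1)))"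
  let ?g = "\<lambda>k. \<Sum>t=1..n. card (array_hits L r k t)"
  have fg: "?f k = int (?g k)" if k: "k \<in> J_arrays n r m" for k
  proof -
    have "?f k = (\<Sum>j=1..r. \<Sum>l=j..m - r + j.
        int (card {i \<in> {1..k j l}. L i = l}) - int (card {i \<in> {1..k j (l - 1)}. L i = l}))"
    proof (intro sum.cong refl)
      fix j l assume j: "j \<in> {1..r}" and l: "l \<in> {j..m - r + j}"
      then have "l \<in> {1..m}" using assms(4) by auto
      moreover from this have "k j l \<le> n" "k j (l - 1) \<le> n"
        using J_arrays_le[OF k j _ assms(4)] by auto
      ultimately show "int (occurrences X \<alpha> l (k j l)) - int (occurrences X \<alpha> l (k j (l - 1))) =
          int (card {i \<in> {1..k j l}. L i = l}) - int (card {i \<in> {1..k j (l - 1)}. L i = l})"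
        by (simp add: occ)
    qed
    then show ?thesis using array_weight_eq[OF k L assms(4)] by simp
  qed
  have "int (\<Sum>j=1..r. rsk_row_length (map X [1..<Suc n]) j) = int (Max (?g ` J_arrays n r m))"
    unfolding rows sum_rows_eq_Max_arrays[OF L assms(4)] ..
  also have "\<dots> = Max (int ` ?g ` J_arrays n r m)"
    using finite_J_arrays[OF assms(4), of n] J_arrays_nonempty[OF assms(4), of n]
    by (intro mono_Max_commute) (auto simp: mono_def)
  also have "int ` ?g ` J_arrays n r m = ?f ` J_arrays n r m"
    unfolding image_image by (intro image_cong refl) (simp only: fg)
  finally show ?thesis .
qed

end
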